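(* Let $\Theta\subset\mathbb R^N$ be open, let $N_c\ge1$ be a fixed integer, and for $\theta\in\Theta$ let $$0=x_0<x_1(\theta)<\cdots<x_{N_c-1}(\theta)<x_{N_c}=1$$ be a partition of $[0,1]$ whose interior points $x_i(\theta)$, $1\le i\le N_c-1$, are $C^1$ functions of $\theta$. Write $I_j(\theta):=(x_{j-1}(\theta),x_j(\theta))$. Let $r(x,\theta)$ be a real-valued function whose restriction to each moving cell $\{(x,\theta):\theta\in\Theta,\ x\in I_j(\theta)\}$ is jointly $C^1$ in $(x,\theta)$ up to the cell endpoints; the one-sided traces of $r$ at an interface $x_i(\theta)$ may differ. Define $$J(\theta)=\frac12\int_0^1r(x,\theta)^2\,dx,\qquad G_k(\theta):=\sum_{j=1}^{N_c}\int_{I_j(\theta)}r(x,\theta)\,\partial_{\theta_k}r(x,\theta)\,dx,$$ where $\partial_{\theta_k}r$ is taken at fixed $x$ within each cell, and $G:=(G_1,\dots,G_N)^T$. Then, for $k=1,\dots,N$, $$\partial_{\theta_k}J(\theta)=G_k(\theta)-\frac12\sum_{i=1}^{N_c-1}[\![r^2]\!]_{x_i}\,\partial_{\theta_k}x_i(\theta).$$ In particular, $\nabla_\theta J=G$ if $r(\cdot,\theta)$ is continuous across every interface.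
   Context: For a function $h$ with one-sided traces at an interface $x_i=x_i(\theta)$, $[\![h]\!]_{x_i}:=h(x_i^+)-h(x_i^-)$. "Jointly $C^1$ up to the cell endpoints" means that $r$ and its first-order partial derivatives in $x$ and $\theta$ extend continuously from the open moving cell to $\{(x,\theta):\theta\in\Theta,\ x_{j-1}(\theta)\le x\le x_j(\theta)\}$. *)

theory Defs
  imports "HOL-Analysis.Analysis"
begin

definition has_partial_deriv ::
    "'n::finite \<Rightarrow> (real^'n \<Rightarrow> real) \<Rightarrow> real \<Rightarrow> real^'n \<Rightarrow> bool" where
  "has_partial_deriv k f D \<theta> \<longleftrightarrow>
     ((\<lambda>t. f (\<theta> + t *\<^sub>R axis k 1)) has_real_derivative D) (at 0)"

(* Meaningful only where the partial derivative exists (deriv is a choice of derivative). *)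
definition partial_deriv :: "'n::finite \<Rightarrow> (real^'n \<Rightarrow> real) \<Rightarrow> real^'n \<Rightarrow> real" where
  "partial_deriv k f \<theta> = deriv (\<lambda>t. f (\<theta> + t *\<^sub>R axis k 1)) 0"

(* Intended for open S. *)
definition C1_on :: "(real^'n::finite) set \<Rightarrow> (real^'n \<Rightarrow> real) \<Rightarrow> bool" where
  "C1_on S f \<longleftrightarrow>
     (\<forall>k. (\<forall>\<theta>\<in>S. \<exists>D. has_partial_deriv k f D \<theta>) \<and> continuous_on S (partial_deriv k f))"

definition moving_cell ::
    "(real^'n::finite) set \<Rightarrow> (real^'n \<Rightarrow> real) \<Rightarrow> (real^'n \<Rightarrow> real) \<Rightarrow> (real \<times> (real^'n)) set" where
  "moving_cell \<Theta> a b = {(x, \<theta>). \<theta> \<in> \<Theta> \<and> a \<theta> < x \<and> x < b \<theta>}"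

(* The closed cell contains its endpoint graphs, but only over the parameters in \<Theta>. *)
definition closed_moving_cell ::
    "(real^'n::finite) set \<Rightarrow> (real^'n \<Rightarrow> real) \<Rightarrow> (real^'n \<Rightarrow> real) \<Rightarrow> (real \<times> (real^'n)) set" where
  "closed_moving_cell \<Theta> a b = {(x, \<theta>). \<theta> \<in> \<Theta> \<and> a \<theta> \<le> x \<and> x \<le> b \<theta>}"

definition extends_continuously ::
    "'a::topological_space set \<Rightarrow> 'a set \<Rightarrow> ('a \<Rightarrow> real) \<Rightarrow> bool" where
  "extends_continuously S T f \<longleftrightarrow> (\<exists>g. continuous_on T g \<and> (\<forall>p\<in>S. g p = f p))"

(* Only values of r in the open cell are constrained; in particular the values of r at the
   interfaces are arbitrary. Continuity of r and of its partial derivatives in the open cell is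
   part of the existence of the continuous extensions. *)
definition C1_up_to_endpoints ::
    "(real^'n::finite) set \<Rightarrow> (real^'n \<Rightarrow> real) \<Rightarrow> (real^'n \<Rightarrow> real) \<Rightarrow>
     (real \<Rightarrow> real^'n \<Rightarrow> real) \<Rightarrow> bool" where
  "C1_up_to_endpoints \<Theta> a b r \<longleftrightarrow>
     (\<forall>(x, \<theta>) \<in> moving_cell \<Theta> a b.
        (\<exists>D. ((\<lambda>y. r y \<theta>) has_real_derivative D) (at x)) \<and>
        (\<forall>k. \<exists>D. has_partial_deriv k (r x) D \<theta>)) \<and>
     extends_continuously (moving_cell \<Theta> a b) (closed_moving_cell \<Theta> a b)
       (\<lambda>(x, \<theta>). r x \<theta>) \<and>
     extends_continuously (moving_cell \<Theta> a b) (closed_moving_cell \<Theta> a b)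
       (\<lambda>(x, \<theta>). deriv (\<lambda>y. r y \<theta>) x) \<and>
     (\<forall>k. extends_continuously (moving_cell \<Theta> a b) (closed_moving_cell \<Theta> a b)
       (\<lambda>(x, \<theta>). partial_deriv k (r x) \<theta>))"

definition jump :: "(real \<Rightarrow> real) \<Rightarrow> real \<Rightarrow> real" where
  "jump h a = Lim (at_right a) h - Lim (at_left a) h"

(* The two one-sided traces exist and agree. This is isCont without the requirement on the value
   h a itself, since values at interfaces are not prescribed. *)
definition continuous_across :: "(real \<Rightarrow> real) \<Rightarrow> real \<Rightarrow> bool" where
  "continuous_across h a \<longleftrightarrow> (\<exists>l. (h \<longlongrightarrow> l) (at_left a) \<and> (h \<longlongrightarrow> l) (at_right a))"

definition J :: "(real \<Rightarrow> real^'n::finite \<Rightarrow> real) \<Rightarrow> real^'n \<Rightarrow> real" where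
  "J r \<theta> = 1/2 * integral {0..1} (\<lambda>x. (r x \<theta>)\<^sup>2)"

definition G ::
    "nat \<Rightarrow> (nat \<Rightarrow> real^'n \<Rightarrow> real) \<Rightarrow> (real \<Rightarrow> real^'n::finite \<Rightarrow> real) \<Rightarrow> real^'n \<Rightarrow> real^'n" where
  "G Nc xs r \<theta> =
     (\<chi> k. \<Sum>j=1..Nc. integral {xs (j - 1) \<theta> <..< xs j \<theta>}
                        (\<lambda>x. r x \<theta> * partial_deriv k (r x) \<theta>))"

end

theory Submission
  imports Defs
begin

text \<open>Rescaling \<open>x = a + s (b - a)\<close> turns the integral over a moving cell into one over \<open>[0,1]\<close>,
where one may differentiate under the integral sign: the derivative is known only for \<open>0 < s < 1\<close>,
but it extends continuously to the closed interval. The terms with \<open>\<partial>\<^sub>x f\<close> are the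
\<open>s\<close>-derivative of \<open>f V\<close>, \<open>V\<close> being the velocity of the rescaled point, and integrate to the boundary
terms. Summing over the cells, the boundary terms at an interface combine to a jump. All this is done
for total derivatives, so that the second claim needs no continuity of \<open>G\<close>.\<close>

section \<open>Total differentiability from continuous partial derivatives\<close>

text \<open>Walk from \<open>z\<close> to \<open>z + h\<close> one coordinate at a time. Once the
  linear part \<open>w \<bullet> p z\<close> is subtracted, continuity of \<open>p\<close> makes
  every partial derivative small near \<open>z\<close>, so by the mean value inequality each leg of
  the walk changes the function by little compared with its length.\<close>

lemma GDERIV_of_continuous_partials:
  fixes f :: "'a::euclidean_space \<Rightarrow> real"
  assumes S: "open S" "z \<in> S"
    and partials: "\<And>w i. w \<in> S \<Longrightarrow> i \<in> Basis \<Longrightarrow>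
      ((\<lambda>t. f (w + t *\<^sub>R i)) has_real_derivative p w \<bullet> i) (at 0)"
    and p: "continuous_on S p"
  shows "GDERIV f z :> p z"
proof -
  \<comment> \<open>Without the expected linear part, the claim becomes that \<open>g\<close> has
    derivative 0 at \<open>z\<close>.\<close>
  define g where "g w = f w - w \<bullet> p z" for w
  \<comment> \<open>The total length of the coordinate path from \<open>z\<close> to
    \<open>z + h\<close>, which bounds the distance of each of its points from
    \<open>z\<close>.\<close>
  define l1 :: "'a \<Rightarrow> real" where "l1 h = (\<Sum>i\<in>Basis. \<bar>h \<bullet> i\<bar>)" for h
  have partials_g: "((\<lambda>t. g (w + t *\<^sub>R i)) has_real_derivative (p w - p z) \<bullet> i) (at 0)"
    if "w \<in> S" "i \<in> Basis" for w i
    unfolding g_def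
    by (rule derivative_eq_intros partials that refl | simp add: algebra_simps inner_commute)+
  have l1_le: "l1 h \<le> DIM('a) * norm h" for h
    unfolding l1_def using sum_bounded_above[of Basis "\<lambda>i. \<bar>h \<bullet> i\<bar>" "norm h"] Basis_le_norm by auto
  have "\<exists>d>0. \<forall>h. norm h < d \<longrightarrow> \<bar>g (z + h) - g z\<bar> \<le> e * norm h" if "e > 0" for e
  proof -
    \<comment> \<open>The division absorbs the factor \<open>DIM('a)\<close> lost in comparing
      \<open>l1\<close> with the norm.\<close>
    define e' where "e' = e / DIM('a)"
    have e': "e' > 0" using \<open>e > 0\<close> by (simp add: e'_def)
    obtain d1 where d1: "d1 > 0" "ball z d1 \<subseteq> S" using S open_contains_ball by blast
    obtain d2 where d2: "d2 > 0" "\<And>w. w \<in> S \<Longrightarrow> dist w z < d2 \<Longrightarrow> dist (p w) (p z) < e'"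
      using p S(2) e' unfolding continuous_on_iff by metis
    define d where "d = min d1 d2"
    have near: "w \<in> S" "norm (p w - p z) \<le> e'" if "norm (w - z) < d" for w
      using d1 d2(2)[of w] that by (auto simp: d_def dist_norm norm_minus_commute subset_iff less_imp_le)
    \<comment> \<open>\<open>B\<close> is the set of coordinates already moved; the induction adds
      one leg of the path at a time.\<close>
    have coordinatewise: "\<bar>g (z + (\<Sum>i\<in>B. (h \<bullet> i) *\<^sub>R i)) - g z\<bar> \<le> (\<Sum>i\<in>B. e' * \<bar>h \<bullet> i\<bar>)"
      if h: "l1 h < d" and "finite B" "B \<subseteq> Basis" for B h
      using that(2,3)
    proof (induction B rule: finite_induct)
      case empty
      then show ?case by simp
    next
      case (insert j B)
      define w where "w = z + (\<Sum>i\<in>B. (h \<bullet> i) *\<^sub>R i)"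
      have inside: "norm (w + t *\<^sub>R j - z) < d" if "t \<in> closed_segment 0 (h \<bullet> j)" for t
      proof -
        have "norm (w + t *\<^sub>R j - z) = norm ((\<Sum>i\<in>B. (h \<bullet> i) *\<^sub>R i) + t *\<^sub>R j)"
          by (simp add: w_def algebra_simps)
        also have "\<dots> \<le> (\<Sum>i\<in>B. norm ((h \<bullet> i) *\<^sub>R i)) + norm (t *\<^sub>R j)"
          by (intro norm_triangle_mono norm_sum order_refl)
        also have "\<dots> = (\<Sum>i\<in>B. \<bar>h \<bullet> i\<bar>) + \<bar>t\<bar>"
          using insert.prems by (auto intro!: sum.cong)
        also have "\<dots> \<le> (\<Sum>i\<in>insert j B. \<bar>h \<bullet> i\<bar>)"
          using that insert.hyps by (auto simp: closed_segment_eq_real_ivl split: if_splits)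
        also have "\<dots> \<le> l1 h"
          unfolding l1_def using insert.prems by (intro sum_mono2) auto
        finally show ?thesis using h by simp
      qed
      have "norm (g (w + (h \<bullet> j) *\<^sub>R j) - g (w + 0 *\<^sub>R j)) \<le> e' * norm (h \<bullet> j - 0)"
      proof (rule field_differentiable_bound[where S = "closed_segment 0 (h \<bullet> j)"
            and f' = "\<lambda>t. (p (w + t *\<^sub>R j) - p z) \<bullet> j"])
        fix t assume t: "t \<in> closed_segment 0 (h \<bullet> j)"
        \<comment> \<open>Partial derivatives are derivatives at parameter 0 of a line through the
          point itself. Shifting the parameter turns this into the derivative at \<open>t\<close>
          along the fixed line through \<open>w\<close>.\<close>
        have "((\<lambda>s. g ((w + t *\<^sub>R j) + s *\<^sub>R j)) has_real_derivative (p (w + t *\<^sub>R j) - p z) \<bullet> j) (at 0)"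
          using partials_g near(1) inside t insert.prems by auto
        moreover have "(\<lambda>s. g ((w + t *\<^sub>R j) + s *\<^sub>R j)) = (\<lambda>s. g (w + (s + t) *\<^sub>R j))"
          by (simp add: algebra_simps)
        ultimately have "((\<lambda>s. g (w + s *\<^sub>R j)) has_real_derivative (p (w + t *\<^sub>R j) - p z) \<bullet> j) (at t)"
          using DERIV_shift[of "\<lambda>s. g (w + s *\<^sub>R j)" _ 0 t] by simp
        then show "((\<lambda>s. g (w + s *\<^sub>R j)) has_real_derivative (p (w + t *\<^sub>R j) - p z) \<bullet> j)
            (at t within closed_segment 0 (h \<bullet> j))"
          by (rule has_field_derivative_at_within)
        have "\<bar>(p (w + t *\<^sub>R j) - p z) \<bullet> j\<bar> \<le> norm (p (w + t *\<^sub>R j) - p z)"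
          using insert.prems by (intro Basis_le_norm) auto
        then show "norm ((p (w + t *\<^sub>R j) - p z) \<bullet> j) \<le> e'"
          using near(2) inside t by fastforce
      qed auto
      moreover have sum_insert: "z + (\<Sum>i\<in>insert j B. (h \<bullet> i) *\<^sub>R i) = w + (h \<bullet> j) *\<^sub>R j"
        using insert.hyps by (simp add: w_def algebra_simps)
      moreover have "\<bar>g w - g z\<bar> \<le> (\<Sum>i\<in>B. e' * \<bar>h \<bullet> i\<bar>)"
        using insert.IH insert.prems by (simp add: w_def)
      ultimately show ?case
        unfolding sum_insert using insert.hyps by simp
    qed
    \<comment> \<open>On this smaller ball \<open>l1 h < d\<close>, so the bound applies with
      \<open>B\<close> the whole basis.\<close>
    have "\<bar>g (z + h) - g z\<bar> \<le> e * norm h" if "norm h < d / DIM('a)" for h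
    proof -
      have "l1 h < d" using l1_le[of h] that by (simp add: field_simps)
      from coordinatewise[OF this, of Basis]
      have "\<bar>g (z + h) - g z\<bar> \<le> e' * l1 h"
        by (simp add: euclidean_representation l1_def sum_distrib_left)
      also have "\<dots> \<le> e' * (DIM('a) * norm h)"
        using e' l1_le by (intro mult_left_mono) auto
      finally show ?thesis by (simp add: e'_def)
    qed
    moreover have "d / DIM('a) > 0" using d1 d2 by (simp add: d_def)
    ultimately show ?thesis by blast
  qed
  then have "(g has_derivative (\<lambda>h. 0)) (at z)"
    unfolding has_derivative_at_alt
    by (simp, metis add.commute diff_add_cancel)
  then have "((\<lambda>w. g w + w \<bullet> p z) has_derivative (\<lambda>h. 0 + h \<bullet> p z)) (at z)"
    by (intro derivative_intros) 
  then show ?thesis by (simp add: g_def gderiv_def)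
qed

section \<open>Differentiation of integrals over fixed and moving intervals\<close>

text \<open>Compactness of \<open>{0..1}\<close> makes the continuity of \<open>P\<close> at
  \<open>z\<close> uniform in \<open>s\<close>. The mean value inequality then bounds the
  first-order remainder for all interior \<open>s\<close> at once, and this bound survives
  integration. At \<open>s = 0\<close> and \<open>s = 1\<close> only the continuous values of
  \<open>P\<close> enter, as is appropriate for extensions from an open cell.\<close>

lemma GDERIV_integral_unit_interval:
  fixes F :: "real \<Rightarrow> 'a::euclidean_space \<Rightarrow> real" and P :: "real \<Rightarrow> 'a \<Rightarrow> 'a"
  assumes U: "open U" "z \<in> U"
    and F: "continuous_on (U \<times> {0..1}) (\<lambda>(w, s). F s w)"
    and P: "continuous_on (U \<times> {0..1}) (\<lambda>(w, s). P s w)"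
    and deriv: "\<And>s w. 0 < s \<Longrightarrow> s < 1 \<Longrightarrow> w \<in> U \<Longrightarrow> GDERIV (F s) w :> P s w"
  shows "GDERIV (\<lambda>w. integral {0..1} (\<lambda>s. F s w)) z :> integral {0..1} (\<lambda>s. P s z)"
proof -
  have contF: "continuous_on {0..1} (\<lambda>s. F s w)" and contP: "continuous_on {0..1} (\<lambda>s. P s w)"
    if "w \<in> U" for w
  proof -
    have "continuous_on {0..1::real} (\<lambda>s. (w, s))" by (intro continuous_intros)
    from continuous_on_compose2[OF F this] continuous_on_compose2[OF P this] that
    show "continuous_on {0..1} (\<lambda>s. F s w)" "continuous_on {0..1} (\<lambda>s. P s w)" by auto
  qed
  define A where "A w = integral {0..1} (\<lambda>s. F s w)" for w
  define D where "D = integral {0..1} (\<lambda>s. P s z)"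
  have "\<exists>d>0. \<forall>w. norm (w - z) < d \<longrightarrow> norm (A w - A z - (w - z) \<bullet> D) \<le> e * norm (w - z)"
    if "e > 0" for e
  proof -
    \<comment> \<open>A single neighbourhood \<open>V\<close> serves every \<open>s\<close>, by
      compactness.\<close>
    obtain V where V: "z \<in> V" "open V" "\<And>w s. w \<in> V \<inter> U \<Longrightarrow> s \<in> {0..1} \<Longrightarrow> dist (P s w) (P s z) \<le> e"
      using continuous_on_prod_compactE[OF P compact_Icc \<open>z \<in> U\<close> \<open>e > 0\<close>]
      by (metis (no_types, lifting) case_prod_conv)
    have "open (V \<inter> U)" "z \<in> V \<inter> U" using U V by auto
    then obtain d where d: "d > 0" "ball z d \<subseteq> V \<inter> U" using open_contains_ball by metis
    have "norm (A w - A z - (w - z) \<bullet> D) \<le> e * norm (w - z)" if w: "norm (w - z) < d" for w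
    proof -
      have ball: "w \<in> ball z d" "z \<in> ball z d" "w \<in> U" "z \<in> U"
        using w d U by (auto simp: dist_norm norm_minus_commute)
      \<comment> \<open>The remainder at fixed \<open>s\<close>; its integral is the remainder of
        \<open>A\<close>.\<close>
      define E where "E s = F s w - F s z - (w - z) \<bullet> P s z" for s
      have E: "\<bar>E s\<bar> \<le> e * norm (w - z)" if s: "s \<in> {0<..<1}" for s
      proof -
        have "norm ((F s w - w \<bullet> P s z) - (F s z - z \<bullet> P s z)) \<le> e * norm (w - z)"
        proof (rule differentiable_bound[where S = "ball z d" and f' = "\<lambda>v h. h \<bullet> P s v - h \<bullet> P s z"])
          fix v assume v: "v \<in> ball z d"
          then have vU: "v \<in> V \<inter> U" using d by blast
          have "((\<lambda>x. F s x - x \<bullet> P s z) has_derivative (\<lambda>h. h \<bullet> P s v - h \<bullet> P s z)) (at v)"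
            using deriv[of s v] s vU by (auto simp: gderiv_def intro!: derivative_intros)
          then show "((\<lambda>x. F s x - x \<bullet> P s z) has_derivative (\<lambda>h. h \<bullet> P s v - h \<bullet> P s z)) (at v within ball z d)"
            by (rule has_derivative_at_withinI)
          have "dist (P s v) (P s z) \<le> e" using V(3)[OF vU] s by auto
          then have "\<bar>h \<bullet> (P s v - P s z)\<bar> \<le> e * norm h" for h
            using order_trans[OF Cauchy_Schwarz_ineq2 mult_left_mono[OF _ norm_ge_zero]]
            by (simp add: dist_norm mult.commute)
          then show "onorm (\<lambda>h. h \<bullet> P s v - h \<bullet> P s z) \<le> e"
            by (intro onorm_le) (simp add: inner_diff_right)
        qed (use ball in auto)
        then show ?thesis by (simp add: E_def inner_diff_left algebra_simps)
      qed
      have "((\<lambda>s. E s) has_integral (A w - A z - (w - z) \<bullet> D)) {0..1}"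
        unfolding E_def A_def D_def
        by (intro has_integral_diff integrable_integral integrable_continuous_interval contF ball
            has_integral_linear[OF _ bounded_linear_inner_right, unfolded o_def] contP)
      \<comment> \<open>The bound on \<open>E\<close> is known for interior \<open>s\<close>;
        dropping the two endpoints leaves the integral unchanged.\<close>
      then have "(E has_integral (A w - A z - (w - z) \<bullet> D)) (box 0 1)"
        by (simp add: has_integral_Icc_iff_Ioo)
      then have *: "A w - A z - (w - z) \<bullet> D = integral {0<..<1} E" "E integrable_on {0<..<1}"
        by (auto simp: integral_unique)
      have "norm (integral {0<..<1} E) \<le> integral {0<..<1::real} (\<lambda>s. e * norm (w - z))"
        using E by (intro integral_norm_bound_integral *)
          (auto simp: integrable_on_Icc_iff_Ioo[symmetric])
      also have "\<dots> = e * norm (w - z)"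
        by (simp add: integral_open_interval_real[symmetric])
      finally show ?thesis using * by simp
    qed
    then show ?thesis using d by blast
  qed
  then show ?thesis
    unfolding gderiv_def has_derivative_at_alt A_def D_def using bounded_linear_inner_left by blast
qed

lemma integral_Icc_eq_unit_interval:
  fixes f :: "real \<Rightarrow> 'a::euclidean_space"
  assumes "a \<le> b" "continuous_on {a..b} f"
  shows "integral {a..b} f = (b - a) *\<^sub>R integral {0..1} (\<lambda>s. f (a + s * (b - a)))"
proof -
  have "a + s * (b - a) \<in> {a..b}" if "s \<in> {0..1}" for s
    using that assms(1) mult_right_mono[of s 1 "b - a"] by auto
  then have "((\<lambda>s. (b - a) *\<^sub>R f (a + s * (b - a))) has_integral integral {a + 0 * (b - a)..a + 1 * (b - a)} f) {0..1}"
    using assms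
    by (intro has_integral_substitution[where c = a and d = b]) (auto intro!: derivative_eq_intros)
  then show ?thesis by (simp add: integral_unique flip: integral_cmul)
qed

text \<open>The Leibniz rule in a form suited to cells: \<open>f\<close> is differentiable in the
  open moving interval, while on the boundary \<open>fx\<close> and \<open>ft\<close> are merely
  continuous extensions. The boundary terms therefore come from the fundamental theorem of calculus
  on the rescaled interval, not from derivatives of \<open>f\<close> at the endpoints.\<close>

lemma GDERIV_integral_moving_interval:
  fixes f :: "real \<times> 'a::euclidean_space \<Rightarrow> real" and a b :: "'a \<Rightarrow> real" and U :: "'a set"
  defines "C \<equiv> {(x, w). w \<in> U \<and> a w \<le> x \<and> x \<le> b w}"
  assumes U: "open U" "z \<in> U"
    and ab: "\<And>w. w \<in> U \<Longrightarrow> a w < b w"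
    and a: "\<And>w. w \<in> U \<Longrightarrow> GDERIV a w :> ga w" "continuous_on U ga"
    and b: "\<And>w. w \<in> U \<Longrightarrow> GDERIV b w :> gb w" "continuous_on U gb"
    and f: "continuous_on C f" and fx: "continuous_on C fx" and ft: "continuous_on C ft"
    and deriv: "\<And>x w. w \<in> U \<Longrightarrow> a w < x \<Longrightarrow> x < b w \<Longrightarrow> GDERIV f (x, w) :> (fx (x, w), ft (x, w))"
  shows "GDERIV (\<lambda>w. integral {a w..b w} (\<lambda>x. f (x, w))) z :>
    f (b z, z) *\<^sub>R gb z - f (a z, z) *\<^sub>R ga z + integral {a z..b z} (\<lambda>x. ft (x, z))"
proof -
  \<comment> \<open>\<open>X w s\<close> is the point at relative position \<open>s\<close> in the
    interval, \<open>V\<close> its gradient in \<open>w\<close>, and \<open>P\<close> the gradient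
    of \<open>F s\<close> given by the chain rule.\<close>
  define X where "X w s = a w + s * (b w - a w)" for w s
  define V where "V w s = ga w + s *\<^sub>R (gb w - ga w)" for w s
  define F where "F s w = f (X w s, w)" for s w
  define P where "P s w = fx (X w s, w) *\<^sub>R V w s + ft (X w s, w)" for s w
  have X_C: "(X w s, w) \<in> C" if "w \<in> U" "s \<in> {0..1}" for w s
  proof -
    have "0 \<le> s * (b w - a w)" "s * (b w - a w) \<le> 1 * (b w - a w)"
      using that ab[of w] by (intro mult_nonneg_nonneg mult_right_mono; simp)+
    then show ?thesis using that by (simp add: C_def X_def)
  qed
  have X_open: "a w < X w s" "X w s < b w" if "w \<in> U" "0 < s" "s < 1" for w s
  proof -
    have "0 < s * (b w - a w)" "s * (b w - a w) < 1 * (b w - a w)"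
      using that ab[of w] by (intro mult_pos_pos mult_strict_right_mono; simp)+
    then show "a w < X w s" "X w s < b w" by (simp_all add: X_def)
  qed
  have cont_ab: "continuous_on U a" "continuous_on U b"
    using a(1) b(1) unfolding gderiv_def
    by (meson continuous_at_imp_continuous_on has_derivative_continuous)+
  have cont_UI: "continuous_on (U \<times> {0..1}) (\<lambda>(w, s). h (X w s, w))"
    if "continuous_on C h" for h :: "real \<times> 'a \<Rightarrow> 'b::topological_space"
  proof -
    have "continuous_on (U \<times> {0..1::real}) (\<lambda>p. (X (fst p) (snd p), fst p))"
      unfolding X_def
      by (intro continuous_intros continuous_on_compose2[OF cont_ab(1)] continuous_on_compose2[OF cont_ab(2)]) auto
    moreover have "(\<lambda>p. (X (fst p) (snd p), fst p)) ` (U \<times> {0..1}) \<subseteq> C"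
      using X_C by (intro image_subsetI) auto
    ultimately show ?thesis
      unfolding case_prod_beta by (rule continuous_on_compose2[OF that])
  qed
  have contV: "continuous_on (U \<times> {0..1}) (\<lambda>(w, s). V w s)"
    unfolding V_def case_prod_beta
    by (intro continuous_intros continuous_on_compose2[OF a(2)] continuous_on_compose2[OF b(2)]) auto
  have contF: "continuous_on (U \<times> {0..1}) (\<lambda>(w, s). F s w)"
    unfolding F_def by (rule cont_UI[OF f])
  have contP: "continuous_on (U \<times> {0..1}) (\<lambda>(w, s). P s w)"
    using cont_UI[OF fx] cont_UI[OF ft] contV unfolding P_def case_prod_beta
    by (intro continuous_intros)
  have slice: "continuous_on {0..1} (h w)"
    if "continuous_on (U \<times> {0..1}) (\<lambda>(w, s). h w s)" "w \<in> U" for h :: "'a \<Rightarrow> real \<Rightarrow> 'b::topological_space" and w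
  proof -
    have "continuous_on {0..1::real} (\<lambda>s. (w, s))" by (intro continuous_intros)
    from continuous_on_compose2[OF that(1) this] that(2) show ?thesis by auto
  qed
  have deriv_F: "GDERIV (F s) w :> P s w" if "0 < s" "s < 1" "w \<in> U" for s w
  proof -
    have "((\<lambda>w. (X w s, w)) has_derivative (\<lambda>h. (h \<bullet> V w s, h))) (at w)"
      using a(1)[OF that(3)] b(1)[OF that(3)] unfolding X_def V_def gderiv_def
      by (auto intro!: derivative_eq_intros simp: algebra_simps inner_diff_right inner_add_right)
    moreover have "(f has_derivative (\<lambda>h. h \<bullet> (fx (X w s, w), ft (X w s, w)))) (at (X w s, w))"
      using deriv X_open that unfolding gderiv_def by blast
    ultimately have "((\<lambda>w. f (X w s, w)) has_derivative
        (\<lambda>h. (h \<bullet> V w s, h) \<bullet> (fx (X w s, w), ft (X w s, w)))) (at w)"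
      by (rule has_derivative_compose)
    then show ?thesis
      by (simp add: gderiv_def F_def[abs_def] P_def inner_add_right mult.commute)
  qed
  have subst: "integral {a w..b w} (\<lambda>x. h (x, w)) = (b w - a w) *\<^sub>R integral {0..1} (\<lambda>s. h (X w s, w))"
    if "w \<in> U" "continuous_on C h" for w and h :: "real \<times> 'a \<Rightarrow> 'b::euclidean_space"
  proof -
    have "continuous_on {a w..b w} (\<lambda>x. (x, w))" by (intro continuous_intros)
    moreover have "(\<lambda>x. (x, w)) ` {a w..b w} \<subseteq> C"
      using that(1) by (auto simp: C_def)
    ultimately have "continuous_on {a w..b w} (\<lambda>x. h (x, w))"
      by (rule continuous_on_compose2[OF that(2)])
    then show ?thesis
      using integral_Icc_eq_unit_interval[of "a w" "b w" "\<lambda>x. h (x, w)"] ab[OF that(1)]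
      by (simp add: X_def)
  qed
  let ?IF = "integral {0..1} (\<lambda>s. F s z)" and ?IP = "integral {0..1} (\<lambda>s. P s z)"
  \<comment> \<open>The interval length and the rescaled integral both depend on \<open>w\<close>,
    hence the product rule.\<close>
  have "GDERIV (\<lambda>w. (b w - a w) * integral {0..1} (\<lambda>s. F s w)) z :>
      (b z - a z) *\<^sub>R ?IP + ?IF *\<^sub>R (gb z - ga z)"
    using U
    by (intro GDERIV_mult GDERIV_diff a b GDERIV_integral_unit_interval[OF U contF contP deriv_F])
  then have "GDERIV (\<lambda>w. integral {a w..b w} (\<lambda>x. f (x, w))) z :>
      (b z - a z) *\<^sub>R ?IP + ?IF *\<^sub>R (gb z - ga z)"
    unfolding gderiv_def
    by (rule has_derivative_transform_within_open[OF _ U]) (simp add: subst[OF _ f] F_def)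
  moreover have "(b z - a z) *\<^sub>R ?IP + ?IF *\<^sub>R (gb z - ga z) =
    f (b z, z) *\<^sub>R gb z - f (a z, z) *\<^sub>R ga z + integral {a z..b z} (\<lambda>x. ft (x, z))"
  proof -
    \<comment> \<open>The derivative of \<open>F s z *\<^sub>R V z s\<close> in \<open>s\<close>:
      \<open>V z\<close> and \<open>X z\<close> are affine in \<open>s\<close>, with slopes
      \<open>gb z - ga z\<close> and \<open>b z - a z\<close>.\<close>
    define \<phi>' where "\<phi>' s = F s z *\<^sub>R (gb z - ga z) + (fx (X z s, z) * (b z - a z)) *\<^sub>R V z s" for s
    have "(\<phi>' has_integral (F 1 z *\<^sub>R V z 1 - F 0 z *\<^sub>R V z 0)) {0..1}"
    \<comment> \<open>Continuity up to the ends and differentiability inside suffice here, which is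
      exactly what the extension of \<open>f\<close> provides.\<close>
    proof (rule fundamental_theorem_of_calculus_interior)
      show "continuous_on {0..1} (\<lambda>s. F s z *\<^sub>R V z s)"
        by (intro continuous_intros slice[OF contF] slice[OF contV] U)
      fix s :: real assume s: "s \<in> {0<..<1}"
      have "((\<lambda>s. (X z s, z)) has_derivative (\<lambda>h. (h * (b z - a z), 0))) (at s)"
        unfolding X_def by (auto intro!: derivative_eq_intros)
      moreover have "(f has_derivative (\<lambda>h. h \<bullet> (fx (X z s, z), ft (X z s, z)))) (at (X z s, z))"
        using deriv X_open s U unfolding gderiv_def by auto
      ultimately have "((\<lambda>s. F s z) has_derivative
          (\<lambda>h. (h * (b z - a z), 0) \<bullet> (fx (X z s, z), ft (X z s, z)))) (at s)"
        unfolding F_def by (rule has_derivative_compose)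
      then have "((\<lambda>s. F s z) has_real_derivative fx (X z s, z) * (b z - a z)) (at s)"
        unfolding has_field_derivative_def by (rule has_derivative_eq_rhs) (simp add: fun_eq_iff)
      moreover have "(V z has_vector_derivative (gb z - ga z)) (at s)"
        unfolding V_def by (auto intro!: derivative_eq_intros)
      ultimately show "((\<lambda>s. F s z *\<^sub>R V z s) has_vector_derivative \<phi>' s) (at s)"
        using has_vector_derivative_scaleR by (fastforce simp: \<phi>'_def)
    qed auto
    moreover have "((\<lambda>s. (b z - a z) *\<^sub>R ft (X z s, z)) has_integral
        (b z - a z) *\<^sub>R integral {0..1} (\<lambda>s. ft (X z s, z))) {0..1}"
      by (intro has_integral_cmul integrable_integral integrable_continuous_interval
          slice[OF cont_UI[OF ft]] U)
    ultimately have "((\<lambda>s. \<phi>' s + (b z - a z) *\<^sub>R ft (X z s, z)) has_integral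
        F 1 z *\<^sub>R V z 1 - F 0 z *\<^sub>R V z 0 + integral {a z..b z} (\<lambda>x. ft (x, z))) {0..1}"
      unfolding subst[OF U(2) ft] by (rule has_integral_add)
    moreover have "((\<lambda>s. (b z - a z) *\<^sub>R P s z + F s z *\<^sub>R (gb z - ga z)) has_integral
        (b z - a z) *\<^sub>R ?IP + ?IF *\<^sub>R (gb z - ga z)) {0..1}"
      by (intro has_integral_add has_integral_cmul has_integral_scaleR_left integrable_integral
          integrable_continuous_interval slice[OF contF] slice[OF contP] U)
    \<comment> \<open>The integrand from the product rule splits into an exact
      \<open>s\<close>-derivative and the \<open>ft\<close> term.\<close>
    moreover have "(b z - a z) *\<^sub>R P s z + F s z *\<^sub>R (gb z - ga z) = \<phi>' s + (b z - a z) *\<^sub>R ft (X z s, z)" for s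
      by (simp add: P_def \<phi>'_def algebra_simps)
    ultimately have "(b z - a z) *\<^sub>R ?IP + ?IF *\<^sub>R (gb z - ga z) =
        F 1 z *\<^sub>R V z 1 - F 0 z *\<^sub>R V z 0 + integral {a z..b z} (\<lambda>x. ft (x, z))"
      by (simp add: has_integral_unique)
    \<comment> \<open>At \<open>s = 1\<close> the point is \<open>b z\<close> with velocity
      \<open>gb z\<close>; at \<open>s = 0\<close> it is \<open>a z\<close> with velocity
      \<open>ga z\<close>.\<close>
    then show ?thesis by (simp add: F_def V_def X_def)
  qed
  ultimately show ?thesis by simp
qed

section \<open>From coordinate partial derivatives to gradients on open cells\<close>

lemma GDERIV_imp_has_partial_deriv:
  assumes "GDERIV f \<theta> :> D"
  shows "has_partial_deriv k f (D $ k) \<theta>"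
proof -
  have "((\<lambda>t. \<theta> + t *\<^sub>R axis k 1) has_derivative (\<lambda>t. t *\<^sub>R axis k 1)) (at 0)"
    by (auto intro!: derivative_eq_intros)
  moreover have "(f has_derivative (\<lambda>h. h \<bullet> D)) (at (\<theta> + 0 *\<^sub>R axis k 1))"
    using assms by (simp add: gderiv_def)
  ultimately have "((\<lambda>t. f (\<theta> + t *\<^sub>R axis k 1)) has_derivative (\<lambda>t. (t *\<^sub>R axis k 1) \<bullet> D)) (at 0)"
    by (rule has_derivative_compose)
  then show ?thesis
    by (simp add: has_partial_deriv_def has_field_derivative_def inner_axis' mult.commute[of _ "D $ k"])
qed

lemma has_partial_deriv_imp_partial_deriv:
  "has_partial_deriv k f D \<theta> \<Longrightarrow> partial_deriv k f \<theta> = D"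
  unfolding has_partial_deriv_def partial_deriv_def by (rule DERIV_imp_deriv)

text \<open>Passes from the coordinatewise notion of a C1 function to the gradient that the Leibniz
  rule requires of the endpoints.\<close>

lemma C1_on_gradient:
  assumes "open S" "C1_on S f"
  shows "continuous_on S (\<lambda>\<theta>. \<chi> k. partial_deriv k f \<theta>)"
    and "\<theta> \<in> S \<Longrightarrow> GDERIV f \<theta> :> (\<chi> k. partial_deriv k f \<theta>)"
proof -
  show cont: "continuous_on S (\<lambda>\<theta>. \<chi> k. partial_deriv k f \<theta>)"
    using assms(2) unfolding C1_on_def by (intro continuous_on_vec_lambda) auto
  assume \<theta>: "\<theta> \<in> S"
  show "GDERIV f \<theta> :> (\<chi> k. partial_deriv k f \<theta>)"
  proof (rule GDERIV_of_continuous_partials[OF assms(1) \<theta> _ cont])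
    fix w and i :: "real^'a" assume w: "w \<in> S" and "i \<in> Basis"
    then obtain k where k: "i = axis k 1" by (auto simp: Basis_vec_def)
    obtain D where D: "has_partial_deriv k f D w"
      using assms(2) w unfolding C1_on_def by blast
    then show "((\<lambda>t. f (w + t *\<^sub>R i)) has_real_derivative (\<chi> k. partial_deriv k f w) \<bullet> i) (at 0)"
      using has_partial_deriv_imp_partial_deriv[OF D]
      by (simp add: k inner_axis has_partial_deriv_def)
  qed
qed

lemma open_moving_cell:
  assumes "open \<Theta>" "continuous_on \<Theta> a" "continuous_on \<Theta> b"
  shows "open (moving_cell \<Theta> a b)"
proof -
  have "continuous_on (UNIV \<times> \<Theta>) (\<lambda>p. (fst p - a (snd p), b (snd p) - fst p))"
    by (intro continuous_intros continuous_on_compose2[OF assms(2)] continuous_on_compose2[OF assms(3)]) auto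
  then have "open ((UNIV \<times> \<Theta>) \<inter> (\<lambda>p. (fst p - a (snd p), b (snd p) - fst p)) -` ({0<..} \<times> {0<..}))"
    using assms(1) by (intro continuous_open_preimage open_Times) auto
  also have "\<dots> = moving_cell \<Theta> a b"
    by (auto simp: moving_cell_def)
  finally show ?thesis .
qed

text \<open>Values of \<open>r\<close> at the interfaces are arbitrary, so analysis up to the
  boundary is done on the extension \<open>R\<close>. Inside the open cell \<open>R\<close> is
  \<open>r\<close>, and there the continuous extensions of its partial derivatives restrict to
  continuous partial derivatives, which yields a total derivative.\<close>

lemma C1_up_to_endpoints_extension:
  fixes r :: "real \<Rightarrow> real^'n::finite \<Rightarrow> real"
  assumes "open \<Theta>" "continuous_on \<Theta> a" "continuous_on \<Theta> b"
    and r: "C1_up_to_endpoints \<Theta> a b r"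
  obtains R :: "real \<times> (real^'n) \<Rightarrow> real" and Rx :: "real \<times> (real^'n) \<Rightarrow> real"
    and Rt :: "real \<times> (real^'n) \<Rightarrow> real^'n"
  where "continuous_on (closed_moving_cell \<Theta> a b) R"
    "continuous_on (closed_moving_cell \<Theta> a b) Rx"
    "continuous_on (closed_moving_cell \<Theta> a b) Rt"
    "\<And>x \<theta>. (x, \<theta>) \<in> moving_cell \<Theta> a b \<Longrightarrow> R (x, \<theta>) = r x \<theta>"
    "\<And>x \<theta> k. (x, \<theta>) \<in> moving_cell \<Theta> a b \<Longrightarrow> Rt (x, \<theta>) $ k = partial_deriv k (r x) \<theta>"
    "\<And>x \<theta>. (x, \<theta>) \<in> moving_cell \<Theta> a b \<Longrightarrow> GDERIV R (x, \<theta>) :> (Rx (x, \<theta>), Rt (x, \<theta>))"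
proof -
  let ?C = "closed_moving_cell \<Theta> a b" and ?M = "moving_cell \<Theta> a b"
  obtain R where R: "continuous_on ?C R" "\<And>p. p \<in> ?M \<Longrightarrow> R p = (\<lambda>(x, \<theta>). r x \<theta>) p"
    using r unfolding C1_up_to_endpoints_def extends_continuously_def by blast
  obtain Rx where Rx: "continuous_on ?C Rx" "\<And>p. p \<in> ?M \<Longrightarrow> Rx p = (\<lambda>(x, \<theta>). deriv (\<lambda>y. r y \<theta>) x) p"
    using r unfolding C1_up_to_endpoints_def extends_continuously_def by blast
  have "\<forall>k. \<exists>g. continuous_on ?C g \<and> (\<forall>p\<in>?M. g p = (\<lambda>(x, \<theta>). partial_deriv k (r x) \<theta>) p)"
    using r unfolding C1_up_to_endpoints_def extends_continuously_def by blast
  then obtain g where g: "\<And>k. continuous_on ?C (g k)"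
      "\<And>k p. p \<in> ?M \<Longrightarrow> g k p = (\<lambda>(x, \<theta>). partial_deriv k (r x) \<theta>) p"
    by metis
  define Rt where "Rt p = (\<chi> k. g k p)" for p
  have Rt: "continuous_on ?C Rt"
    unfolding Rt_def by (intro continuous_on_vec_lambda g)
  have M_C: "?M \<subseteq> ?C" by (auto simp: moving_cell_def closed_moving_cell_def)
  note open_M = open_moving_cell[OF assms(1-3)]
  have "GDERIV R (x, \<theta>) :> (Rx (x, \<theta>), Rt (x, \<theta>))" if M: "(x, \<theta>) \<in> ?M" for x \<theta>
  proof -
    have "GDERIV (\<lambda>(x, \<theta>). r x \<theta>) (x, \<theta>) :> (Rx (x, \<theta>), Rt (x, \<theta>))"
    proof (rule GDERIV_of_continuous_partials[OF open_M M])
      show "continuous_on ?M (\<lambda>p. (Rx p, Rt p))"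
        using Rx(1) Rt M_C by (intro continuous_on_Pair) (auto intro: continuous_on_subset)
      fix w and i :: "real \<times> (real^'n)" assume w: "w \<in> ?M" and i: "i \<in> Basis"
      obtain y \<eta> where y: "w = (y, \<eta>)" by (cases w)
      \<comment> \<open>A basis direction is either the spatial one or a parameter axis, matching
        the two kinds of partial derivative.\<close>
      from i consider "i = (1, 0)" | k where "i = (0, axis k 1)"
        by (auto simp: Basis_prod_def Basis_vec_def)
      then show "((\<lambda>t. (\<lambda>(x, \<theta>). r x \<theta>) (w + t *\<^sub>R i)) has_real_derivative (Rx w, Rt w) \<bullet> i) (at 0)"
      proof cases
        case 1
        obtain D where D: "((\<lambda>x. r x \<eta>) has_real_derivative D) (at y)"
          using r w unfolding C1_up_to_endpoints_def y by blast
        then have "Rx w = D" using Rx(2)[OF w] by (simp add: y DERIV_imp_deriv)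
        then show ?thesis
          using D DERIV_shift[of "\<lambda>x. r x \<eta>" D 0 y] by (simp add: 1 y add.commute)
      next
        case 2
        obtain D where D: "has_partial_deriv k (r y) D \<eta>"
          using r w unfolding C1_up_to_endpoints_def y by blast
        then have "Rt w $ k = D"
          using g(2)[OF w, of k] has_partial_deriv_imp_partial_deriv[OF D] by (simp add: y Rt_def)
        then show ?thesis
          using D by (simp add: 2 y inner_axis has_partial_deriv_def)
      qed
    qed
    then show ?thesis
      unfolding gderiv_def
      by (rule has_derivative_transform_within_open[OF _ open_M M]) (simp add: R(2))
  qed
  moreover have "Rt (x, \<theta>) $ k = partial_deriv k (r x) \<theta>" if "(x, \<theta>) \<in> ?M" for x \<theta> k
    using g(2)[OF that] by (simp add: Rt_def)
  moreover have "R (x, \<theta>) = r x \<theta>" if "(x, \<theta>) \<in> ?M" for x \<theta>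
    using R(2)[OF that] by simp
  ultimately show ?thesis using that R(1) Rx(1) Rt by blast
qed

section \<open>The contribution of a single cell\<close>

text \<open>The Leibniz rule for the square of the extension, with the extension eliminated: its
  endpoint values are rewritten as one-sided limits of \<open>r\<close>, so that the results of
  neighbouring cells can be compared at their common interface.\<close>

lemma moving_cell_square_integral:
  fixes r :: "real \<Rightarrow> real^'n::finite \<Rightarrow> real"
  assumes "open \<Theta>" "\<theta> \<in> \<Theta>"
    and ab: "\<And>\<theta>. \<theta> \<in> \<Theta> \<Longrightarrow> a \<theta> < b \<theta>"
    and a: "\<And>\<theta>. \<theta> \<in> \<Theta> \<Longrightarrow> GDERIV a \<theta> :> ga \<theta>" "continuous_on \<Theta> ga"
    and b: "\<And>\<theta>. \<theta> \<in> \<Theta> \<Longrightarrow> GDERIV b \<theta> :> gb \<theta>" "continuous_on \<Theta> gb"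
    and r: "C1_up_to_endpoints \<Theta> a b r"
  shows "((\<lambda>x. r x \<theta>) \<longlongrightarrow> Lim (at_right (a \<theta>)) (\<lambda>x. r x \<theta>)) (at_right (a \<theta>))"
    and "((\<lambda>x. r x \<theta>) \<longlongrightarrow> Lim (at_left (b \<theta>)) (\<lambda>x. r x \<theta>)) (at_left (b \<theta>))"
    and "(\<lambda>x. (r x \<theta>)\<^sup>2) integrable_on {a \<theta>..b \<theta>}"
    and "GDERIV (\<lambda>\<theta>. integral {a \<theta>..b \<theta>} (\<lambda>x. (r x \<theta>)\<^sup>2)) \<theta> :>
      (Lim (at_left (b \<theta>)) (\<lambda>x. r x \<theta>))\<^sup>2 *\<^sub>R gb \<theta>
      - (Lim (at_right (a \<theta>)) (\<lambda>x. r x \<theta>))\<^sup>2 *\<^sub>R ga \<theta>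
      + 2 *\<^sub>R (\<chi> k. integral {a \<theta><..<b \<theta>} (\<lambda>x. r x \<theta> * partial_deriv k (r x) \<theta>))"
proof -
  let ?C = "closed_moving_cell \<Theta> a b" and ?M = "moving_cell \<Theta> a b"
  have cont_ab: "continuous_on \<Theta> a" "continuous_on \<Theta> b"
    using a(1) b(1) unfolding gderiv_def
    by (meson continuous_at_imp_continuous_on has_derivative_continuous)+
  obtain R :: "real \<times> (real^'n) \<Rightarrow> real" and Rx and Rt :: "real \<times> (real^'n) \<Rightarrow> real^'n" where
    R: "continuous_on ?C R" "\<And>x \<theta>. (x, \<theta>) \<in> ?M \<Longrightarrow> R (x, \<theta>) = r x \<theta>"
    and Rx: "continuous_on ?C Rx"
    and Rt: "continuous_on ?C Rt" "\<And>x \<theta> k. (x, \<theta>) \<in> ?M \<Longrightarrow> Rt (x, \<theta>) $ k = partial_deriv k (r x) \<theta>"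
    and deriv: "\<And>x \<theta>. (x, \<theta>) \<in> ?M \<Longrightarrow> GDERIV R (x, \<theta>) :> (Rx (x, \<theta>), Rt (x, \<theta>))"
    using C1_up_to_endpoints_extension[OF \<open>open \<Theta>\<close> cont_ab r] by metis
  have slice: "continuous_on {a \<theta>..b \<theta>} (\<lambda>x. h (x, \<theta>))"
    if "continuous_on ?C h" "\<theta> \<in> \<Theta>" for h :: "real \<times> (real^'n) \<Rightarrow> 'b::topological_space" and \<theta>
  proof (rule continuous_on_compose2[OF that(1)])
    show "continuous_on {a \<theta>..b \<theta>} (\<lambda>x. (x, \<theta>))" by (intro continuous_intros)
    show "(\<lambda>x. (x, \<theta>)) ` {a \<theta>..b \<theta>} \<subseteq> ?C" using that(2) by (auto simp: closed_moving_cell_def)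
  qed
  have M: "(x, \<theta>) \<in> ?M" if "\<theta> \<in> \<Theta>" "x \<in> {a \<theta><..<b \<theta>}" for x \<theta>
    using that by (simp add: moving_cell_def)
  note lt = ab[OF \<open>\<theta> \<in> \<Theta>\<close>]
  \<comment> \<open>The extension is continuous on the closed interval and equals \<open>r\<close>
    inside, so its endpoint value is the trace of \<open>r\<close>.\<close>
  have "((\<lambda>x. R (x, \<theta>)) \<longlongrightarrow> R (a \<theta>, \<theta>)) (at_right (a \<theta>))"
    using slice[OF R(1) \<open>\<theta> \<in> \<Theta>\<close>] lt
    by (metis at_within_Icc_at_right atLeastAtMost_iff continuous_on order_refl less_imp_le)
  moreover have "eventually (\<lambda>x. R (x, \<theta>) = r x \<theta>) (at_right (a \<theta>))"
    using M[OF \<open>\<theta> \<in> \<Theta>\<close>] R(2) lt by (intro eventually_at_rightI[of _ "b \<theta>"]) auto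
  ultimately have right: "((\<lambda>x. r x \<theta>) \<longlongrightarrow> R (a \<theta>, \<theta>)) (at_right (a \<theta>))"
    by (rule Lim_transform_eventually)
  then have Lim_right: "Lim (at_right (a \<theta>)) (\<lambda>x. r x \<theta>) = R (a \<theta>, \<theta>)"
    by (intro tendsto_Lim) auto
  then show "((\<lambda>x. r x \<theta>) \<longlongrightarrow> Lim (at_right (a \<theta>)) (\<lambda>x. r x \<theta>)) (at_right (a \<theta>))"
    using right by simp
  have "((\<lambda>x. R (x, \<theta>)) \<longlongrightarrow> R (b \<theta>, \<theta>)) (at_left (b \<theta>))"
    using slice[OF R(1) \<open>\<theta> \<in> \<Theta>\<close>] lt
    by (metis at_within_Icc_at_left atLeastAtMost_iff continuous_on order_refl less_imp_le)
  moreover have "eventually (\<lambda>x. R (x, \<theta>) = r x \<theta>) (at_left (b \<theta>))"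
    using M[OF \<open>\<theta> \<in> \<Theta>\<close>] R(2) lt by (intro eventually_at_leftI[of "a \<theta>"]) auto
  ultimately have left: "((\<lambda>x. r x \<theta>) \<longlongrightarrow> R (b \<theta>, \<theta>)) (at_left (b \<theta>))"
    by (rule Lim_transform_eventually)
  then have Lim_left: "Lim (at_left (b \<theta>)) (\<lambda>x. r x \<theta>) = R (b \<theta>, \<theta>)"
    by (intro tendsto_Lim) auto
  then show "((\<lambda>x. r x \<theta>) \<longlongrightarrow> Lim (at_left (b \<theta>)) (\<lambda>x. r x \<theta>)) (at_left (b \<theta>))"
    using left by simp
  \<comment> \<open>On the closed interval \<open>r\<close> and \<open>R\<close> can differ only at
    the two endpoints, a negligible set.\<close>
  have square: "((\<lambda>x. (r x \<theta>)\<^sup>2) has_integral integral {a \<theta>..b \<theta>} (\<lambda>x. (R (x, \<theta>))\<^sup>2)) {a \<theta>..b \<theta>}"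
    if "\<theta> \<in> \<Theta>" for \<theta>
  proof -
    have "((\<lambda>x. (R (x, \<theta>))\<^sup>2) has_integral integral {a \<theta>..b \<theta>} (\<lambda>x. (R (x, \<theta>))\<^sup>2)) (cbox (a \<theta>) (b \<theta>))"
      using slice[OF R(1) that] by (auto intro!: integrable_integral integrable_continuous_interval continuous_intros)
    then have "((\<lambda>x. (r x \<theta>)\<^sup>2) has_integral integral {a \<theta>..b \<theta>} (\<lambda>x. (R (x, \<theta>))\<^sup>2)) (cbox (a \<theta>) (b \<theta>))"
      by (rule has_integral_spike_interior) (use M[OF that] R(2) in auto)
    then show ?thesis by simp
  qed
  then show "(\<lambda>x. (r x \<theta>)\<^sup>2) integrable_on {a \<theta>..b \<theta>}"
    using \<open>\<theta> \<in> \<Theta>\<close> by blast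
  have "GDERIV (\<lambda>\<theta>. integral {a \<theta>..b \<theta>} (\<lambda>x. (R (x, \<theta>))\<^sup>2)) \<theta> :>
      (R (b \<theta>, \<theta>))\<^sup>2 *\<^sub>R gb \<theta> - (R (a \<theta>, \<theta>))\<^sup>2 *\<^sub>R ga \<theta>
      + integral {a \<theta>..b \<theta>} (\<lambda>x. (2 * R (x, \<theta>)) *\<^sub>R Rt (x, \<theta>))"
  proof (rule GDERIV_integral_moving_interval[where f = "\<lambda>p. (R p)\<^sup>2" and fx = "\<lambda>p. 2 * R p * Rx p"
        and ft = "\<lambda>p. (2 * R p) *\<^sub>R Rt p" and U = \<Theta>, folded closed_moving_cell_def])
    show "continuous_on ?C (\<lambda>p. (R p)\<^sup>2)" "continuous_on ?C (\<lambda>p. 2 * R p * Rx p)"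
      "continuous_on ?C (\<lambda>p. (2 * R p) *\<^sub>R Rt p)"
      using R(1) Rx Rt(1) by (auto intro!: continuous_intros)
    fix x \<theta> assume "\<theta> \<in> \<Theta>" "a \<theta> < x" "x < b \<theta>"
    then have "GDERIV R (x, \<theta>) :> (Rx (x, \<theta>), Rt (x, \<theta>))" by (intro deriv M) auto
    from GDERIV_mult[OF this this]
    show "GDERIV (\<lambda>p. (R p)\<^sup>2) (x, \<theta>) :> (2 * R (x, \<theta>) * Rx (x, \<theta>), (2 * R (x, \<theta>)) *\<^sub>R Rt (x, \<theta>))"
      by (simp add: power2_eq_square mult.assoc flip: scaleR_add_left)
  qed (use assms in auto)
  then have "GDERIV (\<lambda>\<theta>. integral {a \<theta>..b \<theta>} (\<lambda>x. (r x \<theta>)\<^sup>2)) \<theta> :>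
      (R (b \<theta>, \<theta>))\<^sup>2 *\<^sub>R gb \<theta> - (R (a \<theta>, \<theta>))\<^sup>2 *\<^sub>R ga \<theta>
      + integral {a \<theta>..b \<theta>} (\<lambda>x. (2 * R (x, \<theta>)) *\<^sub>R Rt (x, \<theta>))"
    unfolding gderiv_def
    by (rule has_derivative_transform_within_open[OF _ assms(1,2)]) (simp add: integral_unique[OF square])
  moreover have "integral {a \<theta>..b \<theta>} (\<lambda>x. (2 * R (x, \<theta>)) *\<^sub>R Rt (x, \<theta>)) =
      2 *\<^sub>R (\<chi> k. integral {a \<theta><..<b \<theta>} (\<lambda>x. r x \<theta> * partial_deriv k (r x) \<theta>))"
  proof (rule vec_eq_iff[THEN iffD2], rule allI)
    fix k
    have "(\<lambda>x. (2 * R (x, \<theta>)) *\<^sub>R Rt (x, \<theta>)) integrable_on {a \<theta>..b \<theta>}"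
      using slice[OF R(1) assms(2)] slice[OF Rt(1) assms(2)]
      by (auto intro!: integrable_continuous_interval continuous_intros)
    then have "integral {a \<theta>..b \<theta>} (\<lambda>x. (2 * R (x, \<theta>)) *\<^sub>R Rt (x, \<theta>)) $ k =
        integral {a \<theta>..b \<theta>} (\<lambda>x. ((2 * R (x, \<theta>)) *\<^sub>R Rt (x, \<theta>)) $ k)"
      using integral_linear[OF _ bounded_linear_vec_nth[of k]] by (simp add: o_def del: vector_scaleR_component)
    \<comment> \<open>Passing to the open interval first is what allows \<open>R\<close> and
      \<open>Rt\<close> to be replaced by \<open>r\<close> and its partial derivative.\<close>
    also have "\<dots> = integral {a \<theta><..<b \<theta>} (\<lambda>x. 2 * (r x \<theta> * partial_deriv k (r x) \<theta>))"
      unfolding integral_open_interval_real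
      using M[OF assms(2)] R(2) Rt(2) by (intro integral_cong) (simp del: greaterThanLessThan_iff)
    finally show "integral {a \<theta>..b \<theta>} (\<lambda>x. (2 * R (x, \<theta>)) *\<^sub>R Rt (x, \<theta>)) $ k =
      (2 *\<^sub>R (\<chi> k. integral {a \<theta><..<b \<theta>} (\<lambda>x. r x \<theta> * partial_deriv k (r x) \<theta>))) $ k"
      by simp
  qed
  ultimately show "GDERIV (\<lambda>\<theta>. integral {a \<theta>..b \<theta>} (\<lambda>x. (r x \<theta>)\<^sup>2)) \<theta> :>
      (Lim (at_left (b \<theta>)) (\<lambda>x. r x \<theta>))\<^sup>2 *\<^sub>R gb \<theta>
      - (Lim (at_right (a \<theta>)) (\<lambda>x. r x \<theta>))\<^sup>2 *\<^sub>R ga \<theta>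
      + 2 *\<^sub>R (\<chi> k. integral {a \<theta><..<b \<theta>} (\<lambda>x. r x \<theta> * partial_deriv k (r x) \<theta>))"
    unfolding Lim_right Lim_left by simp
qed

section \<open>Summation over the cells and the jump terms\<close>

theorem proposition7:
  fixes \<Theta> :: "(real^'n::finite) set"
    and Nc :: nat
    and xs :: "nat \<Rightarrow> real^'n \<Rightarrow> real"
    and r :: "real \<Rightarrow> real^'n \<Rightarrow> real"
  assumes "open \<Theta>"
    and "Nc \<ge> 1"
    and "\<And>\<theta>. \<theta> \<in> \<Theta> \<Longrightarrow> xs 0 \<theta> = 0"
    and "\<And>\<theta>. \<theta> \<in> \<Theta> \<Longrightarrow> xs Nc \<theta> = 1"
    and "\<And>\<theta> j. \<theta> \<in> \<Theta> \<Longrightarrow> j \<in> {1..Nc} \<Longrightarrow> xs (j - 1) \<theta> < xs j \<theta>"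
    and "\<And>i. i \<in> {1..<Nc} \<Longrightarrow> C1_on \<Theta> (xs i)"
    and "\<And>j. j \<in> {1..Nc} \<Longrightarrow> C1_up_to_endpoints \<Theta> (xs (j - 1)) (xs j) r"
  shows "\<forall>\<theta>\<in>\<Theta>.
      (\<forall>k. has_partial_deriv k (J r)
         (G Nc xs r \<theta> $ k
            - 1/2 * (\<Sum>i\<in>{1..<Nc}. jump (\<lambda>x. (r x \<theta>)\<^sup>2) (xs i \<theta>) * partial_deriv k (xs i) \<theta>)) \<theta>) \<and>
      ((\<forall>i\<in>{1..<Nc}. continuous_across (\<lambda>x. r x \<theta>) (xs i \<theta>)) \<longrightarrow>
         GDERIV (J r) \<theta> :> G Nc xs r \<theta>)"
proof
  fix \<theta> assume \<theta>: "\<theta> \<in> \<Theta>"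
  \<comment> \<open>The gradients of the partition points. The default 0 is the correct gradient for
    the fixed points \<open>xs 0\<close> and \<open>xs Nc\<close>, and later removes the outer
    boundary terms.\<close>
  define g where "g i \<theta> = (if i \<in> {1..<Nc} then \<chi> k. partial_deriv k (xs i) \<theta> else 0)" for i \<theta>
  have "GDERIV (xs i) \<eta> :> g i \<eta> \<and> continuous_on \<Theta> (g i)" if "i \<le> Nc" "\<eta> \<in> \<Theta>" for i \<eta>
  proof (cases "i \<in> {1..<Nc}")
    case True
    then have "g i = (\<lambda>\<eta>. \<chi> k. partial_deriv k (xs i) \<eta>)" by (simp add: g_def fun_eq_iff)
    then show ?thesis
      using C1_on_gradient[OF assms(1) assms(6)[OF True]] that by simp
  next
    case False
    \<comment> \<open>Here \<open>i\<close> is 0 or \<open>Nc\<close>. The point is known to be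
      constant on \<Theta> only, and openness of \<Theta> turns this into a zero derivative.\<close>
    then obtain c where c: "\<And>\<eta>. \<eta> \<in> \<Theta> \<Longrightarrow> c = xs i \<eta>"
      using assms(3,4) \<open>i \<le> Nc\<close> by (metis atLeastLessThan_iff le_antisym less_one not_le)
    have "((\<lambda>_. c) has_derivative (\<lambda>h. 0)) (at \<eta>)" by simp
    then have "(xs i has_derivative (\<lambda>h. 0)) (at \<eta>)"
      by (rule has_derivative_transform_within_open[OF _ assms(1) that(2) c])
    moreover have "g i = (\<lambda>\<eta>. 0)" using False by (auto simp: g_def fun_eq_iff)
    ultimately show ?thesis by (simp add: gderiv_def)
  qed
  then have g: "\<And>i \<eta>. i \<le> Nc \<Longrightarrow> \<eta> \<in> \<Theta> \<Longrightarrow> GDERIV (xs i) \<eta> :> g i \<eta>"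
      "\<And>i. i \<le> Nc \<Longrightarrow> continuous_on \<Theta> (g i)"
    using \<theta> by blast+
  note cell = moving_cell_square_integral[OF assms(1) _ assms(5) g(1) g(2) g(1) g(2) assms(7)]
  define A where "A j \<eta> = integral {xs (j - 1) \<eta>..xs j \<eta>} (\<lambda>x. (r x \<eta>)\<^sup>2)" for j \<eta>
  \<comment> \<open>Traces are indexed by the interface: cell \<open>j\<close> carries
    \<open>lt j\<close> at its right end and \<open>rt (j - 1)\<close> at its left end.\<close>
  define lt where "lt i = Lim (at_left (xs i \<theta>)) (\<lambda>x. r x \<theta>)" for i
  define rt where "rt i = Lim (at_right (xs i \<theta>)) (\<lambda>x. r x \<theta>)" for i
  define DA where "DA j = (\<chi> k. integral {xs (j - 1) \<theta><..<xs j \<theta>} (\<lambda>x. r x \<theta> * partial_deriv k (r x) \<theta>))" for j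
  have deriv_A: "GDERIV (A j) \<theta> :> (lt j)\<^sup>2 *\<^sub>R g j \<theta> - (rt (j - 1))\<^sup>2 *\<^sub>R g (j - 1) \<theta> + 2 *\<^sub>R DA j"
    if "j \<in> {1..Nc}" for j
    unfolding A_def[abs_def] lt_def rt_def DA_def by (rule cell(4)) (use \<theta> that in auto)
  have left: "((\<lambda>x. r x \<theta>) \<longlongrightarrow> lt j) (at_left (xs j \<theta>))" if "j \<in> {1..Nc}" for j
    unfolding lt_def by (rule cell(2)) (use \<theta> that in auto)
  have right: "((\<lambda>x. r x \<theta>) \<longlongrightarrow> rt (j - 1)) (at_right (xs (j - 1) \<theta>))" if "j \<in> {1..Nc}" for j
    unfolding rt_def by (rule cell(1)) (use \<theta> that in auto)
  have right': "((\<lambda>x. r x \<theta>) \<longlongrightarrow> rt i) (at_right (xs i \<theta>))" if "i \<in> {1..<Nc}" for i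
    using right[of "Suc i"] that by simp
  have J_eq: "J r \<eta> = 1/2 * (\<Sum>j=1..Nc. A j \<eta>)" if \<eta>: "\<eta> \<in> \<Theta>" for \<eta>
  proof -
    \<comment> \<open>Cells are joined from left to right; the sign claim is carried along because
      combining adjacent intervals requires ordered endpoints.\<close>
    have "((\<lambda>x. (r x \<eta>)\<^sup>2) has_integral (\<Sum>j=1..m. A j \<eta>)) {0..xs m \<eta>} \<and> 0 \<le> xs m \<eta>" if "m \<le> Nc" for m
      using that
    proof (induction m)
      case 0
      then show ?case using assms(3)[OF \<eta>] has_integral_refl(2)[of _ "0::real"] by simp
    next
      case (Suc m)
      have "((\<lambda>x. (r x \<eta>)\<^sup>2) has_integral A (Suc m) \<eta>) {xs m \<eta>..xs (Suc m) \<eta>}"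
        using cell(3)[OF \<eta>, of "Suc m"] Suc.prems by (simp add: A_def integrable_integral)
      moreover have "xs m \<eta> < xs (Suc m) \<eta>"
        using assms(5)[OF \<eta>, of "Suc m"] Suc.prems by simp
      ultimately show ?case
        using Suc by (auto intro: has_integral_combine)
    qed
    from this[of Nc] show ?thesis
      using assms(4)[OF \<eta>] by (simp add: J_def integral_unique)
  qed
  have "GDERIV (\<lambda>\<eta>. 1/2 * (\<Sum>j=1..Nc. A j \<eta>)) \<theta> :>
      (1/2) *\<^sub>R (\<Sum>j=1..Nc. (lt j)\<^sup>2 *\<^sub>R g j \<theta> - (rt (j - 1))\<^sup>2 *\<^sub>R g (j - 1) \<theta> + 2 *\<^sub>R DA j)"
    using deriv_A unfolding gderiv_def inner_scaleR_right inner_sum_right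
    by (intro has_derivative_mult_right has_derivative_sum) auto
  then have "GDERIV (J r) \<theta> :>
      (1/2) *\<^sub>R (\<Sum>j=1..Nc. (lt j)\<^sup>2 *\<^sub>R g j \<theta> - (rt (j - 1))\<^sup>2 *\<^sub>R g (j - 1) \<theta> + 2 *\<^sub>R DA j)"
    unfolding gderiv_def
    by (rule has_derivative_transform_within_open[OF _ assms(1) \<theta>]) (simp add: J_eq)
  \<comment> \<open>Regroup by interfaces: after the index shift in the \<open>rt\<close> sum, each
    interior interface receives \<open>lt\<close> squared from the cell on its left and minus
    \<open>rt\<close> squared from the cell on its right, that is, minus the jump. The factor 2
    before \<open>DA j\<close> cancels against 1/2.\<close>
  also have "(1/2) *\<^sub>R (\<Sum>j=1..Nc. (lt j)\<^sup>2 *\<^sub>R g j \<theta> - (rt (j - 1))\<^sup>2 *\<^sub>R g (j - 1) \<theta> + 2 *\<^sub>R DA j) =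
      G Nc xs r \<theta> - (1/2) *\<^sub>R (\<Sum>i\<in>{1..<Nc}. ((rt i)\<^sup>2 - (lt i)\<^sup>2) *\<^sub>R g i \<theta>)"
  proof -
    have "g 0 \<theta> = 0" "g Nc \<theta> = 0" by (simp_all add: g_def)
    moreover have "(\<Sum>j=1..Nc. (rt (j - 1))\<^sup>2 *\<^sub>R g (j - 1) \<theta>) = (\<Sum>i<Nc. (rt i)\<^sup>2 *\<^sub>R g i \<theta>)"
      by (rule sum.reindex_bij_witness[of _ Suc "\<lambda>j. j - 1"]) auto
    moreover have "{..<Nc} = insert 0 {1..<Nc}" "{1..Nc} = insert Nc {1..<Nc}"
      using \<open>Nc \<ge> 1\<close> by auto
    ultimately have "(\<Sum>j=1..Nc. (lt j)\<^sup>2 *\<^sub>R g j \<theta>) = (\<Sum>i\<in>{1..<Nc}. (lt i)\<^sup>2 *\<^sub>R g i \<theta>)"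
      "(\<Sum>j=1..Nc. (rt (j - 1))\<^sup>2 *\<^sub>R g (j - 1) \<theta>) = (\<Sum>i\<in>{1..<Nc}. (rt i)\<^sup>2 *\<^sub>R g i \<theta>)"
      by simp_all
    moreover have "G Nc xs r \<theta> = (\<Sum>j=1..Nc. DA j)"
      by (simp add: G_def DA_def vec_eq_iff)
    ultimately show ?thesis
      by (simp add: sum.distrib sum_subtractf scaleR_left_diff_distrib scaleR_right_diff_distrib
          scaleR_add_right flip: scaleR_sum_right)
  qed
  finally have deriv_J: "GDERIV (J r) \<theta> :>
      G Nc xs r \<theta> - (1/2) *\<^sub>R (\<Sum>i\<in>{1..<Nc}. ((rt i)\<^sup>2 - (lt i)\<^sup>2) *\<^sub>R g i \<theta>)" .
  have jump: "jump (\<lambda>x. (r x \<theta>)\<^sup>2) (xs i \<theta>) = (rt i)\<^sup>2 - (lt i)\<^sup>2" if "i \<in> {1..<Nc}" for i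
  proof -
    have "Lim (at_right (xs i \<theta>)) (\<lambda>x. (r x \<theta>)\<^sup>2) = (rt i)\<^sup>2"
      using right'[OF that] by (intro tendsto_Lim tendsto_power) auto
    moreover have "Lim (at_left (xs i \<theta>)) (\<lambda>x. (r x \<theta>)\<^sup>2) = (lt i)\<^sup>2"
      using left[of i] that by (intro tendsto_Lim tendsto_power) auto
    ultimately show ?thesis by (simp add: jump_def)
  qed
  have "has_partial_deriv k (J r)
         (G Nc xs r \<theta> $ k
            - 1/2 * (\<Sum>i\<in>{1..<Nc}. jump (\<lambda>x. (r x \<theta>)\<^sup>2) (xs i \<theta>) * partial_deriv k (xs i) \<theta>)) \<theta>" for k
    using GDERIV_imp_has_partial_deriv[OF deriv_J, of k] by (simp add: jump g_def)
  moreover have "GDERIV (J r) \<theta> :> G Nc xs r \<theta>"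
    if across: "\<forall>i\<in>{1..<Nc}. continuous_across (\<lambda>x. r x \<theta>) (xs i \<theta>)"
  proof -
    \<comment> \<open>Equal traces cancel every interface term in the total derivative
      \<open>deriv_J\<close>, leaving \<open>G\<close> as the gradient.\<close>
    have "rt i = lt i" if i: "i \<in> {1..<Nc}" for i
    proof -
      obtain l where "((\<lambda>x. r x \<theta>) \<longlongrightarrow> l) (at_left (xs i \<theta>))" "((\<lambda>x. r x \<theta>) \<longlongrightarrow> l) (at_right (xs i \<theta>))"
        using bspec[OF across i] unfolding continuous_across_def by blast
      then have "lt i = l" "rt i = l"
        unfolding lt_def rt_def by (simp_all add: tendsto_Lim)
      then show ?thesis by simp
    qed
    then show ?thesis using deriv_J by simp
  qed
  ultimately show "(\<forall>k. has_partial_deriv k (J r)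
         (G Nc xs r \<theta> $ k
            - 1/2 * (\<Sum>i\<in>{1..<Nc}. jump (\<lambda>x. (r x \<theta>)\<^sup>2) (xs i \<theta>) * partial_deriv k (xs i) \<theta>)) \<theta>) \<and>
      ((\<forall>i\<in>{1..<Nc}. continuous_across (\<lambda>x. r x \<theta>) (xs i \<theta>)) \<longrightarrow>
         GDERIV (J r) \<theta> :> G Nc xs r \<theta>)"
    by blast
qed

end
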